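(* Let $\Gamma$ be a connected simple graph on $n\geq 3$ vertices. Then $$ \sigma_{t}(\Gamma)\leq \begin{cases} \lceil \frac{n}{4}\rceil \cdot \lfloor \frac{3n}{4}\rfloor \left(n-1-\lceil \frac{n}{4}\rceil \right)^{2}, & \text{if } n \equiv 0 \pmod 4 \text{ or } n \equiv 3 \pmod 4;\\[2pt] \lfloor \frac{n}{4}\rfloor \cdot \lceil \frac{3n}{4}\rceil \left(n-1-\lfloor \frac{n}{4}\rfloor \right)^{2}, & \text{if } n \equiv 1 \pmod 4 \text{ or } n \equiv 2 \pmod 4.\end{cases} $$ If $n \equiv 0 \pmod 4$ or $n \equiv 3 \pmod 4$, equality holds for the split graph $S_{\lceil n/4\rceil, \lfloor 3n/4\rfloor}$, while if $n \equiv 1 \pmod 4$ or $n \equiv 2 \pmod 4$, equality holds for the split graph $S_{\lfloor n/4\rfloor, \lceil 3n/4\rceil}$.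
   Context: All graphs are finite, simple and undirected; $d(v)$ denotes the degree of vertex $v$. The $\sigma_t$-irregularity (sigma total index) of a graph $G$ is $\sigma_{t}(G)=\sum_{\{u,v\}\subseteq V(G)}(d(u)-d(v))^{2}$, the sum over all unordered pairs of distinct vertices. The split graph $S_{a,b}$ is the graph whose vertex set is partitioned into a clique of size $a$ and an independent set of size $b$, where every vertex of the independent set is adjacent to all vertices of the clique. *)

theory Defs
  imports Complex_Main "Graph_Theory.Pair_Digraph" "Graph_Theory.Digraph_Component"
begin

text \<open>
  A finite simple undirected graph is a \<^locale>\<open>pair_graph\<close>: a finite vertex set together with a
  finite, symmetric, loop-free set of ordered pairs, each edge \<open>{u, v}\<close> being represented by the
  two arcs \<open>(u, v)\<close> and \<open>(v, u)\<close>. Hence the out-degree of a vertex (which equals its in-degree) is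
  its degree in the undirected graph.
\<close>

definition degree :: "'a pair_pre_digraph \<Rightarrow> 'a \<Rightarrow> nat" where
  "degree G v = out_degree (with_proj G) v"

lemma degree_eq_card_neighbours:
  "degree G v = card {w. (v, w) \<in> parcs G}"
proof -
  have "out_arcs (with_proj G) v = Pair v ` {w. (v, w) \<in> parcs G}"
    by (auto simp: out_arcs_def)
  then show ?thesis
    by (simp add: degree_def out_degree_def card_image inj_on_def)
qed

text \<open>The summand attached to an unordered pair; it does not depend on the order of \<open>u\<close> and \<open>v\<close>,
  see \<open>sq_degree_diff_pair\<close> below. Degrees are cast to \<^typ>\<open>int\<close> to avoid truncated subtraction.\<close>

definition sq_degree_diff :: "'a pair_pre_digraph \<Rightarrow> 'a set \<Rightarrow> int" where
  "sq_degree_diff G e =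
     (THE s. \<exists>u v. e = {u, v} \<and> s = (int (degree G u) - int (degree G v))\<^sup>2)"

lemma sq_degree_diff_pair:
  "sq_degree_diff G {u, v} = (int (degree G u) - int (degree G v))\<^sup>2"
  unfolding sq_degree_diff_def
  by (rule the_equality) (auto simp: doubleton_eq_iff power2_commute)

definition sigma_t :: "'a pair_pre_digraph \<Rightarrow> int" where
  "sigma_t G = (\<Sum>e | e \<subseteq> pverts G \<and> card e = 2. sq_degree_diff G e)"

text \<open>\<open>split_graph a b G\<close> states that \<open>G\<close> is a copy of the split graph \<open>S\<^sub>a\<^sub>,\<^sub>b\<close>, with
  clique \<open>A\<close> and independent set \<open>B\<close>.\<close>

definition split_graph :: "nat \<Rightarrow> nat \<Rightarrow> 'a pair_pre_digraph \<Rightarrow> bool" where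
  "split_graph a b G \<longleftrightarrow> pair_graph G \<and>
     (\<exists>A B. pverts G = A \<union> B \<and> A \<inter> B = {} \<and> card A = a \<and> card B = b \<and>
        (\<forall>u\<in>A. \<forall>v\<in>A. u \<noteq> v \<longrightarrow> (u, v) \<in> parcs G) \<and>
        (\<forall>u\<in>B. \<forall>v\<in>B. (u, v) \<notin> parcs G) \<and>
        (\<forall>u\<in>A. \<forall>v\<in>B. (u, v) \<in> parcs G))"

lemma split_graph_exists: "\<exists>G :: nat pair_pre_digraph. split_graph a b G"
proof -
  define G :: "nat pair_pre_digraph" where
    "G = \<lparr> pverts = {..<a + b},
           parcs = {(u, v). u < a + b \<and> v < a + b \<and> u \<noteq> v \<and> (u < a \<or> v < a)} \<rparr>"
  have "finite (parcs G)"
    by (rule finite_subset[of _ "{..<a + b} \<times> {..<a + b}"]) (auto simp: G_def)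
  then have "pair_graph G"
    by unfold_locales (auto simp: G_def symmetric_def sym_def)
  moreover have "pverts G = {..<a} \<union> {a..<a + b}"
    by (auto simp: G_def)
  moreover have "{..<a} \<inter> {a..<a + b} = {}" "card {..<a} = a" "card {a..<a + b} = b"
    by auto
  moreover have "\<forall>u\<in>{..<a}. \<forall>v\<in>{..<a}. u \<noteq> v \<longrightarrow> (u, v) \<in> parcs G"
    "\<forall>u\<in>{a..<a + b}. \<forall>v\<in>{a..<a + b}. (u, v) \<notin> parcs G"
    "\<forall>u\<in>{..<a}. \<forall>v\<in>{a..<a + b}. (u, v) \<in> parcs G"
    by (auto simp: G_def)
  ultimately show ?thesis
    unfolding split_graph_def by blast
qed

end

theory Submission
  imports Defs
begin

text \<open>
  For degrees \<open>d\<close> on \<open>n\<close> vertices, \<open>\<sigma>\<^sub>t = n \<Sum>d\<^sup>2 - (\<Sum>d)\<^sup>2\<close> is a convex quadratic form in \<open>d\<close>. Let \<open>H\<close> consist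
  of the vertices of at least average degree. Making \<open>H\<close> a clique raises degrees in \<open>H\<close>, and making
  its complement \<open>L\<close> independent lowers degrees in \<open>L\<close>; both go along the gradient, so by convexity
  \<open>\<sigma>\<^sub>t\<close> does not decrease. Complementing the graph swaps the roles of \<open>H\<close> and \<open>L\<close> and preserves
  \<open>\<sigma>\<^sub>t\<close>, so assume \<open>a = |H| \<le> b = |L|\<close>. If \<open>P = k b + r\<close> edges run between \<open>H\<close> and \<open>L\<close> and \<open>a \<ge> 2\<close>, a bound on the
  sum of squared degrees of a bipartite graph shows that \<open>\<sigma>\<^sub>t\<close> is at most the linear interpolation
  between the cases where exactly \<open>k\<close> or \<open>k + 1\<close> vertices of \<open>H\<close> are joined to all of \<open>L\<close> and the
  others to none. Such a configuration with \<open>a - k - 1 \<le> 2 k\<close> is no better than the split graph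
  with clique size \<open>k\<close>; otherwise replacing \<open>k\<close> by \<open>k + 1\<close> improves it. It remains to maximize
  \<open>x (n - x) (n - 1 - x)\<^sup>2\<close> over the integers.
\<close>

section \<open>The degree irregularity as a convex quadratic form\<close>

definition spread :: "'a set \<Rightarrow> ('a \<Rightarrow> int) \<Rightarrow> int" where
  "spread V d = int (card V) * (\<Sum>v\<in>V. (d v)\<^sup>2) - (\<Sum>v\<in>V. d v)\<^sup>2"

lemma sum_sq_diff:
  fixes d :: "'a \<Rightarrow> int"
  shows "(\<Sum>u\<in>V. (c - d u)\<^sup>2) = int (card V) * c\<^sup>2 - 2 * c * (\<Sum>u\<in>V. d u) + (\<Sum>u\<in>V. (d u)\<^sup>2)"
proof -
  have "(\<Sum>u\<in>V. (c - d u)\<^sup>2) = (\<Sum>u\<in>V. c\<^sup>2 - (2 * c) * d u + (d u)\<^sup>2)"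
    by (simp add: power2_diff algebra_simps)
  also have "\<dots> = int (card V) * c\<^sup>2 - 2 * c * (\<Sum>u\<in>V. d u) + (\<Sum>u\<in>V. (d u)\<^sup>2)"
    by (simp only: sum.distrib sum_subtractf sum_distrib_left sum_constant of_nat_id)
  finally show ?thesis .
qed

text \<open>This form makes nonnegativity and invariance under \<open>d v\<close> to
  \<open>c - d v\<close> evident.\<close>

lemma sum_sq_diff_ordered_pairs:
  fixes d :: "'a \<Rightarrow> int"
  shows "(\<Sum>u\<in>V. \<Sum>v\<in>V. (d u - d v)\<^sup>2) = 2 * spread V d"
  unfolding sum_sq_diff spread_def
  by (simp add: sum.distrib sum_subtractf flip: sum_distrib_left sum_distrib_right)
    (simp add: algebra_simps power2_eq_square)

lemma spread_nonneg: "0 \<le> spread V d"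
proof -
  have "0 \<le> (\<Sum>u\<in>V. \<Sum>v\<in>V. (d u - d v)\<^sup>2)"
    by (intro sum_nonneg) simp
  then show ?thesis
    by (simp add: sum_sq_diff_ordered_pairs)
qed

text \<open>Only differences of values matter. With \<open>c = n - 1\<close> the left-hand side
  belongs to the degrees of the complement graph.\<close>

lemma spread_complement: "spread V (\<lambda>v. c - d v) = spread V d"
proof -
  have "2 * spread V (\<lambda>v. c - d v) = 2 * spread V d"
    unfolding sum_sq_diff_ordered_pairs[symmetric]
    by (intro sum.cong refl) (simp add: power2_commute)
  then show ?thesis by simp
qed

text \<open>Convexity: the gap is exactly the spread of \<open>d' - d\<close>, and
  \<open>2 * (card V * d v - sum d V)\<close> is the partial derivative at \<open>v\<close>.\<close>

lemma spread_tangent: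
  "spread V d + 2 * (\<Sum>v\<in>V. (int (card V) * d v - sum d V) * (d' v - d v)) \<le> spread V d'"
proof -
  define e where "e v = d' v - d v" for v
  have d': "d' v = d v + e v" for v
    by (simp add: e_def)
  have sq: "(\<Sum>v\<in>V. (d' v)\<^sup>2) = (\<Sum>v\<in>V. (d v)\<^sup>2) + 2 * (\<Sum>v\<in>V. d v * e v) + (\<Sum>v\<in>V. (e v)\<^sup>2)"
    by (simp add: d' power2_sum sum.distrib sum_distrib_left algebra_simps)
  have lin: "(\<Sum>v\<in>V. (int (card V) * d v - sum d V) * e v)
      = int (card V) * (\<Sum>v\<in>V. d v * e v) - sum d V * sum e V"
    by (simp add: left_diff_distrib sum_subtractf sum_distrib_left mult.assoc)
  have "sum d' V = sum d V + sum e V"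
    by (simp add: d' sum.distrib)
  then have "spread V d' = spread V d + 2 * (\<Sum>v\<in>V. (int (card V) * d v - sum d V) * e v) + spread V e"
    unfolding spread_def sq lin by (simp add: algebra_simps power2_sum)
  with spread_nonneg[of V e] show ?thesis
    by (simp add: e_def)
qed

lemma sum_doubletons_spread:
  fixes d :: "'a \<Rightarrow> int"
  assumes "finite V" and s: "\<And>u v. s {u, v} = (d u - d v)\<^sup>2"
  shows "(\<Sum>e | e \<subseteq> V \<and> card e = 2. s e) = spread V d"
  using \<open>finite V\<close>
proof (induction V)
  case empty
  have "{e :: 'a set. e \<subseteq> {} \<and> card e = 2} = {}" by auto
  then show ?case by (simp only: spread_def) simp
next
  case (insert x V)
  have split: "{e. e \<subseteq> insert x V \<and> card e = 2} = {e. e \<subseteq> V \<and> card e = 2} \<union> (\<lambda>v. {x, v}) ` V"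
    using insert.hyps(2) by (auto simp: card_2_iff)
  have disj: "{e. e \<subseteq> V \<and> card e = 2} \<inter> (\<lambda>v. {x, v}) ` V = {}"
    using insert.hyps(2) by auto
  have inj: "inj_on (\<lambda>v. {x, v}) V"
    by (auto simp: inj_on_def doubleton_eq_iff)
  have "(\<Sum>e | e \<subseteq> insert x V \<and> card e = 2. s e) = spread V d + (\<Sum>v\<in>V. (d x - d v)\<^sup>2)"
    unfolding split using insert disj
    by (subst sum.union_disjoint) (auto simp: sum.reindex[OF inj] s)
  also have "\<dots> = spread (insert x V) d"
    unfolding sum_sq_diff spread_def using insert.hyps
    by (simp add: algebra_simps power2_sum)
  finally show ?case .
qed

lemma sigma_t_eq_spread:
  assumes "finite (pverts G)"
  shows "sigma_t G = spread (pverts G) (\<lambda>v. int (degree G v))"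
  unfolding sigma_t_def by (rule sum_doubletons_spread[OF assms]) (rule sq_degree_diff_pair)

section \<open>Squared degrees in bipartite graphs\<close>

text \<open>At \<open>x = \<delta>\<close> with \<open>\<bar>\<delta>\<bar> \<le> b\<close> this equals \<open>b \<bar>\<delta>\<bar> - \<delta>\<^sup>2\<close>. Being a subadditive
  function on \<open>\<int>/b\<int>\<close>, it allows the edge count modulo \<open>b\<close> to be bounded by differences of column sums.\<close>

definition arc_residue :: "int \<Rightarrow> int \<Rightarrow> int" where
  "arc_residue b x = (x mod b) * (b - x mod b)"

text \<open>For residues \<open>u\<close>, \<open>v\<close> the gap is \<open>2 * u * v\<close>
  without wrap-around and \<open>2 * (b - u) * (b - v)\<close> with it.\<close>

lemma arc_residue_add:
  assumes "b > 0"
  shows "arc_residue b (x + y) \<le> arc_residue b x + arc_residue b y"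
proof -
  define u v where "u = x mod b" and "v = y mod b"
  have uv: "0 \<le> u" "u < b" "0 \<le> v" "v < b"
    using assms by (auto simp: u_def v_def)
  have m: "(x + y) mod b = (u + v) mod b"
    by (simp add: u_def v_def mod_add_eq)
  have "(u + v) mod b * (b - (u + v) mod b) \<le> u * (b - u) + v * (b - v)"
  proof (cases "u + v < b")
    case True
    then have "(u + v) mod b = u + v" using uv by simp
    moreover have "0 \<le> u * v" using uv by simp
    ultimately show ?thesis by (simp add: algebra_simps)
  next
    case False
    then have eq: "(u + v) mod b = u + v - b"
      using uv mod_pos_pos_trivial[of "u + v - b" b] by simp
    have "0 \<le> (b - u) * (b - v)" using uv by simp
    then show ?thesis unfolding eq by (simp add: algebra_simps)
  qed
  then show ?thesis
    by (simp add: arc_residue_def m u_def v_def)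
qed

lemma arc_residue_sum:
  assumes "b > 0"
  shows "arc_residue b (\<Sum>j\<in>J. f j) \<le> (\<Sum>j\<in>J. arc_residue b (f j))"
proof (induction J rule: infinite_finite_induct)
  case (insert j J)
  then show ?case
    using arc_residue_add[OF assms, of "f j" "sum f J"] by simp
qed (simp_all add: arc_residue_def)

lemma arc_residue_abs:
  assumes "\<bar>x\<bar> \<le> b" "b > 0"
  shows "arc_residue b x = \<bar>x\<bar> * (b - \<bar>x\<bar>)"
proof -
  consider "x = b" | "0 \<le> x" "x < b" | "x = - b" | "- b < x" "x < 0"
    using assms by linarith
  then show ?thesis
  proof cases
    case 4
    then have "x mod b = x + b"
      using mod_pos_pos_trivial[of "x + b" b] by simp
    with 4 show ?thesis by (simp add: arc_residue_def algebra_simps)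
  qed (use assms in \<open>auto simp: arc_residue_def\<close>)
qed

text \<open>For a fixed column \<open>j'\<close> the differences \<open>q j - q j'\<close> add up to
  \<open>P\<close> modulo \<open>b\<close>, so subadditivity bounds the residue term of
  \<open>P\<close> by column distances. Averaging over \<open>j'\<close> turns these into squared
  row and column sums. The condition \<open>card I \<le> card J\<close> keeps every difference in
  the range of \<open>arc_residue_abs\<close>.\<close>

lemma bipartite_sum_squares_bound:
  fixes \<chi> :: "'a \<Rightarrow> 'b \<Rightarrow> int"
  assumes fin: "finite I" "finite J" and le: "card I \<le> card J" and J: "J \<noteq> {}"
    and \<chi>: "\<And>i j. \<chi> i j \<in> {0, 1}"
  defines "p \<equiv> \<lambda>i. \<Sum>j\<in>J. \<chi> i j" and "q \<equiv> \<lambda>j. \<Sum>i\<in>I. \<chi> i j" and "b \<equiv> int (card J)"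
  defines "P \<equiv> \<Sum>i\<in>I. p i"
  shows "2 * b * ((\<Sum>i\<in>I. (p i)\<^sup>2) + (\<Sum>j\<in>J. (q j)\<^sup>2)) + b * arc_residue b P \<le> 2 * b\<^sup>2 * P + 2 * P\<^sup>2"
proof -
  have b: "b > 0" using fin J by (simp add: b_def card_gt_0_iff)
  have sq: "(\<chi> i j)\<^sup>2 = \<chi> i j" for i j using \<chi>[of i j] by auto
  have Pq: "P = (\<Sum>j\<in>J. q j)"
    unfolding P_def p_def q_def by (rule sum.swap)
  \<comment> \<open>The Hamming distance of columns \<open>j\<close> and \<open>j'\<close>, squared
    so that \<open>sum_sq_diff_ordered_pairs\<close> applies to rows.\<close>
  define D where "D j j' = (\<Sum>i\<in>I. (\<chi> i j - \<chi> i j')\<^sup>2)" for j j'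
  have D: "\<bar>q j - q j'\<bar> \<le> D j j'" for j j'
  proof -
    have "\<bar>q j - q j'\<bar> \<le> (\<Sum>i\<in>I. \<bar>\<chi> i j - \<chi> i j'\<bar>)"
      unfolding q_def sum_subtractf[symmetric] by (rule sum_abs)
    also have "\<dots> \<le> D j j'"
      unfolding D_def
    proof (rule sum_mono)
      fix i
      show "\<bar>\<chi> i j - \<chi> i j'\<bar> \<le> (\<chi> i j - \<chi> i j')\<^sup>2"
        using \<chi>[of i j] \<chi>[of i j'] by auto
    qed
    finally show ?thesis .
  qed
  have q: "0 \<le> q j \<and> q j \<le> b" for j
  proof -
    have "\<chi> i j \<le> 1" "0 \<le> \<chi> i j" for i using \<chi>[of i j] by auto
    then have "q j \<le> (\<Sum>i\<in>I. 1)" "0 \<le> q j"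
      unfolding q_def by (intro sum_mono sum_nonneg; simp)+
    then show ?thesis using le by (simp add: b_def)
  qed
  have col: "arc_residue b P \<le> (\<Sum>j\<in>J. b * D j j' - (q j - q j')\<^sup>2)" for j'
  proof -
    have "(\<Sum>j\<in>J. q j - q j') = P - b * q j'"
      by (simp add: sum_subtractf Pq b_def)
    then have "arc_residue b P = arc_residue b (\<Sum>j\<in>J. q j - q j')"
      by (simp add: arc_residue_def mod_diff_eq[symmetric])
    also have "\<dots> \<le> (\<Sum>j\<in>J. arc_residue b (q j - q j'))"
      by (rule arc_residue_sum[OF b])
    also have "\<dots> \<le> (\<Sum>j\<in>J. b * D j j' - (q j - q j')\<^sup>2)"
    proof (rule sum_mono)
      fix j
      have "arc_residue b (q j - q j') = \<bar>q j - q j'\<bar> * (b - \<bar>q j - q j'\<bar>)"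
        using q[of j] q[of j'] b by (intro arc_residue_abs) auto
      also have "\<dots> = b * \<bar>q j - q j'\<bar> - (q j - q j')\<^sup>2"
        by (simp add: right_diff_distrib power2_eq_square[symmetric] mult.commute)
      also have "\<dots> \<le> b * D j j' - (q j - q j')\<^sup>2"
        using D b by simp
      finally show "arc_residue b (q j - q j') \<le> \<dots>" .
    qed
    finally show ?thesis .
  qed
  have "b * arc_residue b P = (\<Sum>j'\<in>J. arc_residue b P)"
    by (simp add: b_def)
  also have "\<dots> \<le> (\<Sum>j'\<in>J. \<Sum>j\<in>J. b * D j j' - (q j - q j')\<^sup>2)"
    by (intro sum_mono col)
  also have "\<dots> = b * (\<Sum>j'\<in>J. \<Sum>j\<in>J. D j j') - (\<Sum>j'\<in>J. \<Sum>j\<in>J. (q j - q j')\<^sup>2)"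
    by (simp add: sum_subtractf sum_distrib_left)
  also have "(\<Sum>j'\<in>J. \<Sum>j\<in>J. (q j - q j')\<^sup>2) = 2 * (b * (\<Sum>j\<in>J. (q j)\<^sup>2) - P\<^sup>2)"
    using sum_sq_diff_ordered_pairs[of q J] by (subst power2_commute) (simp add: spread_def b_def Pq)
  \<comment> \<open>Double counting: row \<open>i\<close> separates
    \<open>2 * p i * (b - p i)\<close> ordered pairs of columns.\<close>
  also have "(\<Sum>j'\<in>J. \<Sum>j\<in>J. D j j') = (\<Sum>j'\<in>J. \<Sum>i\<in>I. \<Sum>j\<in>J. (\<chi> i j' - \<chi> i j)\<^sup>2)"
    unfolding D_def by (subst power2_commute) (intro sum.cong refl sum.swap)
  also have "\<dots> = (\<Sum>i\<in>I. \<Sum>j'\<in>J. \<Sum>j\<in>J. (\<chi> i j' - \<chi> i j)\<^sup>2)"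
    by (rule sum.swap)
  also have "\<dots> = (\<Sum>i\<in>I. 2 * (b * p i - (p i)\<^sup>2))"
    by (simp add: sum_sq_diff_ordered_pairs spread_def sq p_def b_def)
  also have "\<dots> = 2 * (b * P - (\<Sum>i\<in>I. (p i)\<^sup>2))"
    by (simp add: sum_subtractf sum_distrib_left P_def)
  finally show ?thesis
    by (simp add: algebra_simps power2_eq_square)
qed

section \<open>Staircase configurations and interpolation between them\<close>

text \<open>\<open>split_value n x\<close> is \<open>\<sigma>\<^sub>t\<close> of \<open>S\<^sub>x\<^sub>,\<^sub>n\<^sub>-\<^sub>x\<close>, and \<open>staircase_value a b k\<close> is \<open>\<sigma>\<^sub>t\<close> of the graph
  consisting of a clique of size \<open>a\<close> and \<open>b\<close> independent vertices, each joined to the same \<open>k\<close>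
  vertices of the clique.\<close>

definition split_value :: "int \<Rightarrow> int \<Rightarrow> int" where
  "split_value n x = x * (n - x) * (n - 1 - x)\<^sup>2"

definition staircase_value :: "int \<Rightarrow> int \<Rightarrow> int \<Rightarrow> int" where
  "staircase_value a b k =
     b * (a * (a - 1)\<^sup>2 + k * ((a + b) * b + 2 * (b - a) * (a - 1)) + k\<^sup>2 * (a - 3 * b))"

text \<open>Here \<open>z\<close> counts the clique vertices not joined to the independent set;
  deleting the edges among them gives the split graph. The gap factors, and
  \<open>z - 1 \<le> 2 * k\<close> settles the sign of its last factor.\<close>

lemma staircase_value_le_split_value:
  assumes "0 \<le> k" "0 \<le> z" "z - 1 \<le> 2 * k" "k + z \<le> b"
  shows "staircase_value (k + z) b k \<le> split_value (k + z + b) k"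
proof -
  have "split_value (k + z + b) k - staircase_value (k + z) b k
      = z * (z - 1) * (k * (z - 1) + b * (2 * k - (z - 1)))"
    unfolding staircase_value_def split_value_def by algebra
  moreover have "0 \<le> z * (z - 1) * (k * (z - 1) + b * (2 * k - (z - 1)))"
  proof (cases "z = 0")
    case False
    with assms show ?thesis by (intro mult_nonneg_nonneg add_nonneg_nonneg) auto
  qed simp
  ultimately show ?thesis by linarith
qed

text \<open>The value is concave in \<open>k\<close>, so the increment is smallest at the largest
  admissible \<open>k\<close>. Over the integers \<open>2 * k < a - k - 1\<close> gives
  \<open>3 * (2 * k + 1) \<le> 2 * a - 1\<close>; the remaining inequality is expanded in
  \<open>a\<close> and \<open>b - a\<close>.\<close>

lemma staircase_value_step:
  assumes "0 \<le> k" "2 * k < a - k - 1" "a \<le> b"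
  shows "staircase_value a b k \<le> staircase_value a b (k + 1)"
proof -
  have "3 * ((2 * k + 1) * (3 * b - a)) = (3 * (2 * k + 1)) * (3 * b - a)" by simp
  also have "\<dots> \<le> (2 * a - 1) * (3 * b - a)"
    using assms by (intro mult_right_mono) auto
  also have "\<dots> \<le> 3 * ((a + b) * b + 2 * (b - a) * (a - 1))"
  proof -
    have "0 \<le> 2 * (a * a) + 3 * ((b - a) * (b - a)) + 2 * a + 6 * (a * (b - a)) + 3 * ((b - a) * (a - 1))"
      using assms by (intro add_nonneg_nonneg mult_nonneg_nonneg) auto
    then show ?thesis by (simp add: algebra_simps)
  qed
  finally have "0 \<le> b * ((a + b) * b + 2 * (b - a) * (a - 1) - (2 * k + 1) * (3 * b - a))"
    using assms by (intro mult_nonneg_nonneg) auto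
  also have "\<dots> = staircase_value a b (k + 1) - staircase_value a b k"
    unfolding staircase_value_def by algebra
  finally show ?thesis by simp
qed

lemma staircase_value_le:
  assumes M: "\<And>x. 0 \<le> x \<Longrightarrow> x \<le> a + b \<Longrightarrow> split_value (a + b) x \<le> M"
    and "0 \<le> k" "k \<le> a" "a \<le> b"
  shows "staircase_value a b k \<le> M"
  using assms(2,3)
proof (induction "nat (a - k)" arbitrary: k rule: less_induct)
  case less
  show ?case
  proof (cases "a - k - 1 \<le> 2 * k")
    case True
    then have "staircase_value a b k \<le> split_value (a + b) k"
      using staircase_value_le_split_value[of k "a - k" b] less.prems \<open>a \<le> b\<close> by simp
    also have "\<dots> \<le> M"
      using M less.prems \<open>a \<le> b\<close> by simp
    finally show ?thesis .
  next
    case False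
    then have "staircase_value a b k \<le> staircase_value a b (k + 1)"
      using less.prems \<open>a \<le> b\<close> by (intro staircase_value_step) auto
    also have "\<dots> \<le> M"
      using False less.prems by (intro less.hyps) auto
    finally show ?thesis .
  qed
qed

text \<open>Without its residue term, the bound on \<open>S\<close> gives a concave quadratic in
  \<open>P\<close> through the staircase values at multiples of \<open>b\<close>. The residue term
  pushes it below the chord.\<close>

lemma bipartite_value_le:
  fixes a b P S M :: int
  assumes M: "\<And>x. 0 \<le> x \<Longrightarrow> x \<le> a + b \<Longrightarrow> split_value (a + b) x \<le> M"
    and ab: "2 \<le> a" "a \<le> b" and P: "0 \<le> P" "P \<le> a * b"
    and S: "2 * b * S + b * ((P mod b) * (b - P mod b)) \<le> 2 * b\<^sup>2 * P + 2 * P\<^sup>2"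
  shows "(a + b) * S + 2 * (b - a) * (a - 1) * P - 4 * P\<^sup>2 + a * b * (a - 1)\<^sup>2 \<le> M"
    (is "?T \<le> M")
proof -
  define k r where "k = P div b" and "r = P mod b"
  have r: "0 \<le> r" "r < b" and k: "0 \<le> k"
    using ab P by (auto simp: k_def r_def pos_imp_zdiv_nonneg_iff)
  have Pkr: "P = k * b + r" by (simp add: k_def r_def)
  have "k \<le> a"
    using P ab zdiv_mono1[of P "a * b" b] by (simp add: k_def)
  then have gk: "staircase_value a b k \<le> M"
    using M k ab by (intro staircase_value_le) auto
  \<comment> \<open>If \<open>r = 0\<close>, then \<open>k + 1\<close> may exceed \<open>a\<close>,
    but its weight vanishes.\<close>
  have gk1: "r * staircase_value a b (k + 1) \<le> r * M"
  proof (cases "r = 0")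
    case False
    have "k < a"
    proof (rule ccontr)
      assume "\<not> k < a"
      then have "a * b \<le> k * b" using ab by (intro mult_right_mono) auto
      with Pkr P r False show False by linarith
    qed
    then show ?thesis
      using M k ab r by (intro mult_left_mono staircase_value_le) auto
  qed simp
  have "(a + b) * (2 * b * S) \<le> (a + b) * (2 * b\<^sup>2 * P + 2 * P\<^sup>2 - b * (r * (b - r)))"
    using S ab by (intro mult_left_mono) (auto simp: r_def)
  \<comment> \<open>The left side is the scaled excess of the quadratic over its chord. This uses
    \<open>2 \<le> a\<close>: it fails for \<open>a = 1\<close>, \<open>b = 2\<close>,
    \<open>r = 1\<close>.\<close>
  moreover have "(8 * b - 2 * (a + b)) * (r * (b - r)) \<le> (a + b) * b * (r * (b - r))"
  proof (rule mult_right_mono)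
    have "0 \<le> (a - 2) * b + (b - 2)\<^sup>2 + 2 * (a - 2)"
      using ab by (intro add_nonneg_nonneg mult_nonneg_nonneg) auto
    also have "\<dots> = (a + b) * b - (8 * b - 2 * (a + b))" by algebra
    finally show "8 * b - 2 * (a + b) \<le> (a + b) * b" by simp
    show "0 \<le> r * (b - r)" using r by simp
  qed
  moreover have "(a + b) * (2 * b\<^sup>2 * P + 2 * P\<^sup>2) - (8 * b - 2 * (a + b)) * (r * (b - r))
      + 2 * b * (2 * (b - a) * (a - 1) * P - 4 * P\<^sup>2 + a * b * (a - 1)\<^sup>2)
    = 2 * ((b - r) * staircase_value a b k + r * staircase_value a b (k + 1))"
    unfolding staircase_value_def Pkr by algebra
  ultimately have "2 * b * ?T \<le> 2 * ((b - r) * staircase_value a b k + r * staircase_value a b (k + 1))"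
    by (simp add: algebra_simps)
  also have "\<dots> \<le> 2 * ((b - r) * M + r * M)"
  proof -
    have "(b - r) * staircase_value a b k \<le> (b - r) * M"
      using gk r by (intro mult_left_mono) auto
    from add_mono[OF this gk1] show ?thesis by (rule mult_left_mono) simp
  qed
  also have "\<dots> = 2 * b * M" by (simp add: algebra_simps)
  finally show ?thesis using ab by simp
qed

section \<open>Maximizing the split graph value over the integers\<close>

lemma split_value_step:
  "split_value n (x + 1) - split_value n x
    = (n - 1 - x) * ((n - x) * (n - 4 * x) - 4 * n + 8 * x + 4)"
  unfolding split_value_def by algebra

lemma split_value_mono:
  assumes "\<And>x. 0 \<le> x \<Longrightarrow> x < c \<Longrightarrow> 0 \<le> (n - x) * (n - 4 * x) - 4 * n + 8 * x + 4"
    and "0 \<le> x" "x \<le> c" "c < n"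
  shows "split_value n x \<le> split_value n c"
  using assms(3,2)
proof (induction x rule: int_le_induct)
  case (step i)
  have "0 \<le> (n - 1 - (i - 1)) * ((n - (i - 1)) * (n - 4 * (i - 1)) - 4 * n + 8 * (i - 1) + 4)"
    using step assms(1)[of "i - 1"] assms(4) by (intro mult_nonneg_nonneg) auto
  with step split_value_step[of n "i - 1"] show ?case by simp
qed simp

lemma split_value_antimono:
  assumes "\<And>x. c \<le> x \<Longrightarrow> x < n - 1 \<Longrightarrow> (n - x) * (n - 4 * x) - 4 * n + 8 * x + 4 \<le> 0"
    and "c \<le> x" "x \<le> n"
  shows "split_value n x \<le> split_value n c"
  using assms(2,3)
proof (induction x rule: int_ge_induct)
  case (step i)
  have "(n - 1 - i) * ((n - i) * (n - 4 * i) - 4 * n + 8 * i + 4) \<le> 0"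
    \<comment> \<open>At \<open>i = n - 1\<close> the assumption says nothing, but the factor
      \<open>n - 1 - i\<close> is zero.\<close>
    using step assms(1)[of i] by (cases "i = n - 1") (auto intro: mult_nonneg_nonpos)
  with step split_value_step[of n i] show ?case by simp
qed simp

text \<open>Here \<open>m\<close> is \<open>n / 4\<close> rounded to the nearest integer, ties going
  down. The forward difference is nonnegative below \<open>m\<close> and nonpositive from
  \<open>m\<close> on.\<close>

lemma split_value_max:
  assumes n: "n = 4 * m + s" and s: "s \<in> {-1, 0, 1, 2}" and "n \<ge> 3" and x: "0 \<le> x" "x \<le> n"
  shows "split_value n x \<le> split_value n m"
proof -
  have m: "m \<ge> 1" using assms by auto
  show ?thesis
  proof (cases "x \<le> m")
    case True
    show ?thesis
    proof (rule split_value_mono)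
      fix y assume y: "0 \<le> y" "y < m"
      define t where "t = m - 1 - y"
      have "0 \<le> t" "t \<le> m - 1" using y by (auto simp: t_def)
      have yt: "y = m - 1 - t" by (simp add: t_def)
      \<comment> \<open>After substituting \<open>y = m - 1 - t\<close>, every summand is
        nonnegative for the four values of \<open>s\<close>.\<close>
      have "0 \<le> m * (4 + 3 * s) + 12 * ((m - 1) * t) + s * (s + 1) + t * (12 + 5 * s) + 4 * (t * t)"
      proof -
        have "0 \<le> s * (s + 1)" "0 \<le> 4 + 3 * s" "0 \<le> 12 + 5 * s" using s by auto
        with m \<open>0 \<le> t\<close> show ?thesis
          by (intro add_nonneg_nonneg) simp_all
      qed
      also have "\<dots> = (n - y) * (n - 4 * y) - 4 * n + 8 * y + 4"
        unfolding n yt by algebra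
      finally show "0 \<le> (n - y) * (n - 4 * y) - 4 * n + 8 * y + 4" .
    qed (use x m True n s in auto)
  next
    case False
    show ?thesis
    proof (rule split_value_antimono)
      fix y assume y: "m \<le> y" "y < n - 1"
      \<comment> \<open>The distances of \<open>y\<close> from the ends \<open>m\<close> and
        \<open>n - 2\<close> of its range; the quadratic factor is then an affine term minus
        \<open>4 * t * w\<close>.\<close>
      define t w where "t = y - m" and "w = n - 2 - y"
      have t: "0 \<le> t" "0 \<le> w" "w \<le> 3 * m + s - 2" using y n by (auto simp: t_def w_def)
      have "s * (w + 1) - 3 * s - 8 * m + 4 \<le> 0"
        using s m t by auto
      moreover have "0 \<le> t * w" using t by simp
      moreover have "(n - y) * (n - 4 * y) - 4 * n + 8 * y + 4
          = s * (w + 1) - 3 * s - 8 * m + 4 - 4 * (t * w)"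
        unfolding n t_def w_def by (simp add: algebra_simps)
      ultimately show "(n - y) * (n - 4 * y) - 4 * n + 8 * y + 4 \<le> 0" by linarith
    qed (use x False in auto)
  qed
qed

section \<open>Reduction to a clique and an independent set\<close>

text \<open>Keeping \<open>\<chi>\<close> an arbitrary 0/1 matrix lets the bound serve both a graph
  and its complement. A clique of size at most one is treated directly, since the interpolation
  requires \<open>2 \<le> a\<close>.\<close>

lemma spread_clique_independent_le:
  fixes d :: "'a \<Rightarrow> int" and \<chi> :: "'a \<Rightarrow> 'a \<Rightarrow> int"
  assumes fin: "finite H" "finite L" and disj: "H \<inter> L = {}" and le: "card H \<le> card L"
    and n: "n = int (card H) + int (card L)" "n \<ge> 3"
    and \<chi>: "\<And>i j. \<chi> i j \<in> {0, 1}"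
    and dH: "\<And>i. i \<in> H \<Longrightarrow> d i = int (card H) - 1 + (\<Sum>j\<in>L. \<chi> i j)"
    and dL: "\<And>j. j \<in> L \<Longrightarrow> d j = (\<Sum>i\<in>H. \<chi> i j)"
    and M: "\<And>x. 0 \<le> x \<Longrightarrow> x \<le> n \<Longrightarrow> split_value n x \<le> M"
  shows "spread (H \<union> L) d \<le> M"
proof -
  define a b where "a = int (card H)" and "b = int (card L)"
  define p where "p i = (\<Sum>j\<in>L. \<chi> i j)" for i
  define q where "q j = (\<Sum>i\<in>H. \<chi> i j)" for j
  define P where "P = (\<Sum>i\<in>H. p i)"
  define S where "S = (\<Sum>i\<in>H. (p i)\<^sup>2) + (\<Sum>j\<in>L. (q j)\<^sup>2)"
  have nab: "n = a + b" using n by (simp add: a_def b_def)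
  have ab: "0 \<le> a" "a \<le> b" "0 < b" using le n nab by (auto simp: a_def b_def)
  have \<chi>01: "0 \<le> \<chi> i j" "\<chi> i j \<le> 1" "(\<chi> i j)\<^sup>2 = \<chi> i j" for i j
    using \<chi>[of i j] by auto
  have p: "0 \<le> p i" "p i \<le> b" for i
    using \<chi>01 sum_mono[of L "\<chi> i" "\<lambda>_. 1"] by (auto simp: p_def b_def intro: sum_nonneg)
  have P: "0 \<le> P" "P \<le> a * b"
    using p sum_mono[of H p "\<lambda>_. b"] by (auto simp: P_def a_def intro: sum_nonneg)
  have Pq: "(\<Sum>j\<in>L. q j) = P"
    unfolding P_def p_def q_def by (rule sum.swap)
  have d: "d i = (a - 1) + p i" if "i \<in> H" for i
    using dH[OF that] by (simp add: a_def p_def)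
  have "(\<Sum>i\<in>H. (d i)\<^sup>2) = (\<Sum>i\<in>H. (a - 1)\<^sup>2 + (p i)\<^sup>2 + 2 * (a - 1) * p i)"
    by (intro sum.cong refl) (simp add: d power2_sum)
  also have "\<dots> = a * (a - 1)\<^sup>2 + (\<Sum>i\<in>H. (p i)\<^sup>2) + 2 * (a - 1) * P"
    by (simp add: sum.distrib P_def a_def flip: sum_distrib_left)
  finally have sqH: "(\<Sum>i\<in>H. (d i)\<^sup>2) = \<dots>" .
  have sqL: "(\<Sum>j\<in>L. (d j)\<^sup>2) = (\<Sum>j\<in>L. (q j)\<^sup>2)" and sL: "(\<Sum>j\<in>L. d j) = P"
    unfolding Pq[symmetric] by (auto intro!: sum.cong simp: dL q_def)
  have sH: "(\<Sum>i\<in>H. d i) = a * (a - 1) + P"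
    by (simp add: d sum.distrib P_def a_def)
  have card: "int (card (H \<union> L)) = a + b"
    using fin disj by (simp add: card_Un_disjoint a_def b_def)
  have T: "spread (H \<union> L) d = (a + b) * S + 2 * (b - a) * (a - 1) * P - 4 * P\<^sup>2 + a * b * (a - 1)\<^sup>2"
    unfolding spread_def card sum.union_disjoint[OF fin disj] sqH sqL sL sH S_def by algebra
  consider "a = 0" | "a = 1" | "2 \<le> a" using ab by linarith
  then show ?thesis
  proof cases
    case 1
    then have "H = {}" using fin by (simp add: a_def)
    then have "spread (H \<union> L) d = split_value n 0"
      unfolding T using 1 by (simp add: S_def P_def q_def split_value_def)
    then show ?thesis using M[of 0] n by simp
  next
    case 2
    then obtain h where h: "H = {h}" by (auto simp: a_def card_1_singleton_iff)
    have S: "S = P\<^sup>2 + P"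
      unfolding S_def Pq[symmetric] by (simp add: h q_def p_def P_def \<chi>01)
    \<comment> \<open>For \<open>b = 2\<close> this is \<open>(2 - P) * (1 - P)\<close>, whose sign
      relies on \<open>P\<close> being an integer.\<close>
    have "0 \<le> (b - P) * ((b - 3) * (b + P) + b + 1)"
    proof (cases "b = 2")
      case True
      then have "P = 0 \<or> P = 1 \<or> P = 2" using P 2 by auto
      with True show ?thesis by auto
    qed (use P 2 n nab in auto)
    also have "\<dots> = split_value n 1 - spread (H \<union> L) d"
      unfolding T nab 2 S split_value_def
      by (simp add: algebra_simps power2_eq_square)
    finally show ?thesis using M[of 1] n by simp
  next
    case 3
    have "2 * b * S + b * arc_residue b P \<le> 2 * b\<^sup>2 * P + 2 * P\<^sup>2"
      unfolding S_def P_def p_def q_def b_def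
      by (rule bipartite_sum_squares_bound) (use fin le \<chi> ab in \<open>auto simp: b_def\<close>)
    then show ?thesis
      unfolding T using 3 P ab M nab by (intro bipartite_value_le) (auto simp: arc_residue_def)
  qed
qed

lemma degree_eq_sum_adjacency:
  assumes "finite V" "\<And>w. (v, w) \<in> parcs G \<Longrightarrow> w \<in> V"
  shows "int (degree G v) = (\<Sum>w\<in>V. of_bool ((v, w) \<in> parcs G))"
proof -
  have "{w. (v, w) \<in> parcs G} = {w \<in> V. (v, w) \<in> parcs G}" using assms by auto
  then show ?thesis
    using assms(1) by (simp add: degree_eq_card_neighbours of_bool_def sum.If_cases Int_def)
qed

lemma sigma_t_le:
  fixes G :: "'a pair_pre_digraph"
  assumes G: "pair_graph G" and n: "n = int (card (pverts G))" "n \<ge> 3"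
    and M: "\<And>x. 0 \<le> x \<Longrightarrow> x \<le> n \<Longrightarrow> split_value n x \<le> M"
  shows "sigma_t G \<le> M"
proof -
  interpret pair_graph G by (rule G)
  define V where "V = pverts G"
  have V: "finite V" by (simp add: V_def pair_finite_verts)
  define d where "d v = int (degree G v)" for v
  \<comment> \<open>Comparison with the average, free of division; it fixes the sign of the gradient
    coordinate at \<open>v\<close>.\<close>
  define H where "H = {v \<in> V. sum d V \<le> n * d v}"
  define L where "L = V - H"
  define \<chi> :: "'a \<Rightarrow> 'a \<Rightarrow> int" where "\<chi> u v = of_bool ((u, v) \<in> parcs G)" for u v
  have HL: "finite H" "finite L" "H \<inter> L = {}" "H \<union> L = V"
    using V by (auto simp: H_def L_def)
  have \<chi>_sym: "\<chi> u v = \<chi> v u" for u v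
    using pair_sym_arcs by (auto simp: \<chi>_def symmetric_def sym_def)
  have d: "d v = (\<Sum>w\<in>H. \<chi> v w) + (\<Sum>w\<in>L. \<chi> v w)" for v
  proof -
    have "d v = (\<Sum>w\<in>V. \<chi> v w)"
      unfolding d_def \<chi>_def using in_arcsD2 V by (intro degree_eq_sum_adjacency) (auto simp: V_def)
    also have "\<dots> = (\<Sum>w\<in>H. \<chi> v w) + (\<Sum>w\<in>L. \<chi> v w)"
      using HL sum.union_disjoint[of H L "\<chi> v"] by simp
    finally show ?thesis .
  qed
  have clique: "(\<Sum>w\<in>H. \<chi> v w) \<le> int (card H) - 1" if "v \<in> H" for v
  proof -
    have "\<chi> v v = 0" using pair_no_loops[of "(v, v)"] by (auto simp: \<chi>_def)
    then have "(\<Sum>w\<in>H. \<chi> v w) = (\<Sum>w\<in>H - {v}. \<chi> v w)"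
      using sum.remove[OF HL(1) that, of "\<chi> v"] by simp
    also have "\<dots> \<le> (\<Sum>w\<in>H - {v}. 1)"
      by (intro sum_mono) (simp add: \<chi>_def)
    also have "\<dots> = int (card H) - 1"
      using card_Suc_Diff1[OF HL(1) that] by simp
    finally show ?thesis .
  qed
  \<comment> \<open>Degrees once \<open>H\<close> is a clique and \<open>L\<close> independent, with
    the arcs between them unchanged.\<close>
  define d' where "d' v = (if v \<in> H then int (card H) - 1 + (\<Sum>w\<in>L. \<chi> v w) else (\<Sum>w\<in>H. \<chi> w v))" for v
  have "0 \<le> (n * d v - sum d V) * (d' v - d v)" if "v \<in> V" for v
  proof (cases "v \<in> H")
    case True
    then show ?thesis
      using clique[OF True] d[of v] by (intro mult_nonneg_nonneg) (auto simp: d'_def H_def)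
  next
    case False
    have "0 \<le> (\<Sum>w\<in>L. \<chi> v w)" by (intro sum_nonneg) (simp add: \<chi>_def)
    then show ?thesis
      using False d[of v] that \<chi>_sym[of v] by (intro mult_nonpos_nonpos) (auto simp: d'_def H_def)
  qed
  then have "0 \<le> (\<Sum>v\<in>V. (n * d v - sum d V) * (d' v - d v))"
    by (intro sum_nonneg)
  then have "spread V d \<le> spread V d'"
    using spread_tangent[of V d d'] n by (simp add: V_def)
  moreover have "sigma_t G = spread V d"
    unfolding V_def d_def[abs_def] by (rule sigma_t_eq_spread) (rule pair_finite_verts)
  moreover have "spread V d' \<le> M"
  proof -
    have cV: "n = int (card H) + int (card L)"
      unfolding n(1) V_def[symmetric] using HL card_Un_disjoint[of H L] by simp
    have L: "v \<notin> H" if "v \<in> L" for v using that by (simp add: L_def)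
    show ?thesis
    proof (cases "card H \<le> card L")
      case True
      show ?thesis
        unfolding HL(4)[symmetric]
        by (rule spread_clique_independent_le[where \<chi> = \<chi> and n = n])
          (use HL True cV n(2) M L in \<open>auto simp: d'_def \<chi>_def\<close>)
    next
      case False
      \<comment> \<open>In the complement \<open>L\<close> is the clique and \<open>H\<close> is
        independent.\<close>
      have "spread (L \<union> H) (\<lambda>v. (n - 1) - d' v) \<le> M"
        by (rule spread_clique_independent_le[where \<chi> = "\<lambda>u v. 1 - \<chi> v u" and n = n])
          (use HL False cV n(2) M L \<chi>_sym in \<open>auto simp: d'_def \<chi>_def sum_subtractf\<close>)
      then show ?thesis
        unfolding spread_complement using HL by (simp add: Un_commute)
    qed
  qed
  ultimately show ?thesis by simp
qed

section \<open>Split graphs attain the bound\<close>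

text \<open>Since \<open>a \<ge> 1\<close>, some clique vertex is adjacent to all others, which
  gives connectedness. The degrees are \<open>a + b - 1\<close> on the clique and \<open>a\<close>
  elsewhere.\<close>

lemma split_graph_properties:
  assumes S: "split_graph a b S" and a: "a \<ge> 1"
  shows split_graph_connected: "Digraph_Component.connected (with_proj S)"
    and card_split_graph: "card (pverts S) = a + b"
    and sigma_t_split_graph: "sigma_t S = split_value (int a + int b) (int a)"
proof -
  interpret pair_graph S using S unfolding split_graph_def by (rule conjunct1)
  obtain A B where AB: "pverts S = A \<union> B" "A \<inter> B = {}" "card A = a" "card B = b"
    and AA: "\<forall>u\<in>A. \<forall>v\<in>A. u \<noteq> v \<longrightarrow> (u, v) \<in> parcs S"
    and BB: "\<forall>u\<in>B. \<forall>v\<in>B. (u, v) \<notin> parcs S"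
    and arcAB: "\<forall>u\<in>A. \<forall>v\<in>B. (u, v) \<in> parcs S"
    using S unfolding split_graph_def by (elim conjE exE) (rule that; assumption)
  have fin: "finite A" "finite B" using pair_finite_verts AB by auto
  show card: "card (pverts S) = a + b"
    using AB fin by (simp add: card_Un_disjoint)
  have arcBA: "(v, u) \<in> parcs S" if "u \<in> A" "v \<in> B" for u v
    using arcAB that pair_sym_arcs by (auto simp: symmetric_def sym_def)
  obtain c where c: "c \<in> A" using a AB by fastforce
  have to_c: "u = c \<or> (u, c) \<in> parcs S \<and> (c, u) \<in> parcs S" if "u \<in> pverts S" for u
    using that AB AA arcAB arcBA c by auto
  have "(u, v) \<in> rtrancl_on (pverts S) ((parcs S)\<^sup>s)" if "u \<in> pverts S" "v \<in> pverts S" for u v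
  proof -
    have "c \<in> pverts S" using c AB by simp
    then have "(c, v) \<in> rtrancl_on (pverts S) ((parcs S)\<^sup>s)"
      using to_c[OF that(2)] that
      by (auto simp: symcl_def intro: rtrancl_on.intros rtrancl_consistent_rtrancl_on)
    then show ?thesis
      using to_c[OF that(1)] that
      by (auto simp: symcl_def intro: converse_rtrancl_on_into_rtrancl_on)
  qed
  then show "Digraph_Component.connected (with_proj S)"
    using c AB by (auto simp: connected_conv)
  have dA: "int (degree S u) = int a + int b - 1" if "u \<in> A" for u
  proof -
    have "{w. (u, w) \<in> parcs S} = pverts S - {u}"
      using that AB AA arcAB pair_no_loops[of "(u, u)"] by (auto dest: in_arcsD2)
    then have "degree S u = card (pverts S) - 1"
      using that AB pair_finite_verts by (simp add: degree_eq_card_neighbours card_Diff_singleton)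
    then show ?thesis using card a by simp
  qed
  have dB: "int (degree S u) = int a" if "u \<in> B" for u
  proof -
    have "{w. (u, w) \<in> parcs S} = A"
      using that AB BB arcBA by (auto dest: in_arcsD2)
    then show ?thesis using AB by (simp add: degree_eq_card_neighbours)
  qed
  have "sigma_t S = spread (A \<union> B) (\<lambda>v. int (degree S v))"
    using sigma_t_eq_spread pair_finite_verts AB(1) by metis
  also have "\<dots> = (int a + int b) * (int a * (int a + int b - 1)\<^sup>2 + int b * (int a)\<^sup>2)
      - (int a * (int a + int b - 1) + int b * int a)\<^sup>2"
    unfolding spread_def using fin AB dA dB by (simp add: sum.union_disjoint card_Un_disjoint)
  also have "\<dots> = split_value (int a + int b) (int a)"
    unfolding split_value_def by algebra
  finally show "sigma_t S = split_value (int a + int b) (int a)" .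
qed

text \<open>Writing \<open>n = 4 * m + s\<close> treats all four residue classes at once.\<close>

lemma split_graph_extremal:
  fixes \<Gamma> :: "'a pair_pre_digraph" and n :: nat and m :: int
  assumes \<Gamma>: "pair_graph \<Gamma>" "card (pverts \<Gamma>) = n" "n \<ge> 3"
    and n: "int n = 4 * m + s" "s \<in> {-1, 0, 1, 2}" and k: "k = int n - m"
  shows "sigma_t \<Gamma> \<le> m * k * (int n - 1 - m)\<^sup>2 \<and>
    (\<forall>S :: 'b pair_pre_digraph. split_graph (nat m) (nat k) S \<longrightarrow>
      Digraph_Component.connected (with_proj S) \<and> card (pverts S) = n \<and>
      sigma_t S = m * k * (int n - 1 - m)\<^sup>2)"
proof (intro conjI allI impI)
  have m: "1 \<le> m" "0 \<le> k" using assms by auto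
  have v: "split_value (int n) m = m * k * (int n - 1 - m)\<^sup>2"
    by (simp add: split_value_def k)
  show "sigma_t \<Gamma> \<le> m * k * (int n - 1 - m)\<^sup>2"
    unfolding v[symmetric] using \<Gamma> by (intro sigma_t_le[where n = "int n"] split_value_max[OF n]) auto
  fix S :: "'b pair_pre_digraph"
  assume S: "split_graph (nat m) (nat k) S"
  show "Digraph_Component.connected (with_proj S)" "card (pverts S) = n"
    "sigma_t S = m * k * (int n - 1 - m)\<^sup>2"
    using split_graph_properties[OF S] m k v by auto
qed

theorem theorem9:
  fixes \<Gamma> :: "'a pair_pre_digraph" and n :: nat
  assumes "pair_graph \<Gamma>"
    and "Digraph_Component.connected (with_proj \<Gamma>)"
    and "card (pverts \<Gamma>) = n"
    and "n \<ge> 3"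
  shows "(n mod 4 = 0 \<or> n mod 4 = 3 \<longrightarrow>
      sigma_t \<Gamma> \<le> \<lceil>real n / 4\<rceil> * \<lfloor>3 * real n / 4\<rfloor> * (int n - 1 - \<lceil>real n / 4\<rceil>)\<^sup>2 \<and>
      (\<forall>S :: 'b pair_pre_digraph. split_graph (nat \<lceil>real n / 4\<rceil>) (nat \<lfloor>3 * real n / 4\<rfloor>) S \<longrightarrow>
        Digraph_Component.connected (with_proj S) \<and> card (pverts S) = n \<and>
        sigma_t S = \<lceil>real n / 4\<rceil> * \<lfloor>3 * real n / 4\<rfloor> * (int n - 1 - \<lceil>real n / 4\<rceil>)\<^sup>2)) \<and>
    (n mod 4 = 1 \<or> n mod 4 = 2 \<longrightarrow>
      sigma_t \<Gamma> \<le> \<lfloor>real n / 4\<rfloor> * \<lceil>3 * real n / 4\<rceil> * (int n - 1 - \<lfloor>real n / 4\<rfloor>)\<^sup>2 \<and>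
      (\<forall>S :: 'b pair_pre_digraph. split_graph (nat \<lfloor>real n / 4\<rfloor>) (nat \<lceil>3 * real n / 4\<rceil>) S \<longrightarrow>
        Digraph_Component.connected (with_proj S) \<and> card (pverts S) = n \<and>
        sigma_t S = \<lfloor>real n / 4\<rfloor> * \<lceil>3 * real n / 4\<rceil> * (int n - 1 - \<lfloor>real n / 4\<rfloor>)\<^sup>2))"
proof (intro conjI[of "_ \<longrightarrow> _"] impI)
  assume "n mod 4 = 0 \<or> n mod 4 = 3"
  then obtain m :: int and s :: int where ms: "int n = 4 * m + s" "s \<in> {-1, 0}"
  proof
    assume "n mod 4 = 0"
    then show ?thesis by (intro that[of "int n div 4" 0]) (presburger, simp)
  next
    \<comment> \<open>Here \<open>n / 4\<close> rounds up, hence \<open>s = -1\<close>.\<close>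
    assume "n mod 4 = 3"
    then show ?thesis by (intro that[of "(int n + 1) div 4" "- 1"]) (presburger, simp)
  qed
  have r: "real n = 4 * of_int m + of_int s" using ms(1) by linarith
  have c: "\<lceil>real n / 4\<rceil> = m"
    using ms(2) unfolding r by (intro ceiling_unique) auto
  \<comment> \<open>As \<open>3 * n / 4 = n - n / 4\<close>, its floor is \<open>n\<close> minus the
    ceiling of \<open>n / 4\<close>.\<close>
  have f: "\<lfloor>3 * real n / 4\<rfloor> = int n - m"
    using ms(2) unfolding ms(1) r by (intro floor_unique) auto
  show "sigma_t \<Gamma> \<le> \<lceil>real n / 4\<rceil> * \<lfloor>3 * real n / 4\<rfloor> * (int n - 1 - \<lceil>real n / 4\<rceil>)\<^sup>2 \<and>
      (\<forall>S :: 'b pair_pre_digraph. split_graph (nat \<lceil>real n / 4\<rceil>) (nat \<lfloor>3 * real n / 4\<rfloor>) S \<longrightarrow>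
        Digraph_Component.connected (with_proj S) \<and> card (pverts S) = n \<and>
        sigma_t S = \<lceil>real n / 4\<rceil> * \<lfloor>3 * real n / 4\<rfloor> * (int n - 1 - \<lceil>real n / 4\<rceil>)\<^sup>2)"
    unfolding c f using assms ms by (intro split_graph_extremal) auto
next
  assume "n mod 4 = 1 \<or> n mod 4 = 2"
  then obtain m :: int and s :: int where ms: "int n = 4 * m + s" "s \<in> {1, 2}"
  proof
    assume "n mod 4 = 1"
    then show ?thesis by (intro that[of "int n div 4" 1]) (presburger, simp)
  next
    assume "n mod 4 = 2"
    then show ?thesis by (intro that[of "int n div 4" 2]) (presburger, simp)
  qed
  have r: "real n = 4 * of_int m + of_int s" using ms(1) by linarith
  have c: "\<lfloor>real n / 4\<rfloor> = m"
    using ms(2) unfolding r by (intro floor_unique) auto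
  have f: "\<lceil>3 * real n / 4\<rceil> = int n - m"
    using ms(2) unfolding ms(1) r by (intro ceiling_unique) auto
  show "sigma_t \<Gamma> \<le> \<lfloor>real n / 4\<rfloor> * \<lceil>3 * real n / 4\<rceil> * (int n - 1 - \<lfloor>real n / 4\<rfloor>)\<^sup>2 \<and>
      (\<forall>S :: 'b pair_pre_digraph. split_graph (nat \<lfloor>real n / 4\<rfloor>) (nat \<lceil>3 * real n / 4\<rceil>) S \<longrightarrow>
        Digraph_Component.connected (with_proj S) \<and> card (pverts S) = n \<and>
        sigma_t S = \<lfloor>real n / 4\<rfloor> * \<lceil>3 * real n / 4\<rceil> * (int n - 1 - \<lfloor>real n / 4\<rfloor>)\<^sup>2)"
    unfolding c f using assms ms by (intro split_graph_extremal) auto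
qed

end
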